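(* Let $\mathcal{O}$ be a non-symmetric operad and $\pi\in\mathcal{O}(2)$ a multiplication on $\mathcal{O}$. Let $D,\overline{D}\in\mathcal{O}(1)$ be such that $d_\pi(D)=d_\pi(\overline{D})=0$ (i.e. $D$ and $\overline{D}$ are both $1$-cocycles). If moreover $D\circ\overline{D}=\overline{D}\circ D$, then $$\pi_t=\sum_{n=0}^\infty\frac{t^n}{n!}\,\{\pi\}\{D^n,\overline{D}^n\}=-\sum_{n=0}^\infty\frac{t^n}{n!}\,D^n\cdot\overline{D}^n$$ defines a deformation of $\pi$.
   Context: All vector spaces are over a field $\mathbb{K}$ of characteristic $0$. A non-symmetric operad is a collection $\mathcal{O}=\{\mathcal{O}(n)\}_{n\ge 1}$ of vector spaces with bilinear partial compositions $\circ_i:\mathcal{O}(m)\otimes\mathcal{O}(n)\to\mathcal{O}(m+n-1)$, $1\le i\le m$, such that for $f\in\mathcal{O}(m), g\in\mathcal{O}(n), h\in\mathcal{O}(p)$: $(f\circ_i g)\circ_{i+j-1}h=f\circ_i(g\circ_j h)$ for $1\le i\le m,\ 1\le j\le n$; $(f\circ_i g)\circ_{j+n-1}h=(f\circ_j h)\circ_i g$ for $1\le i<j\le m$; and an element $\mathrm{id}\in\mathcal{O}(1)$ with $f\circ_i\mathrm{id}=f=\mathrm{id}\circ_1 f$. For $f\in\mathcal{O}(n)$ put $|f|=n-1$. The circle product is $f\circ g=\sum_{i=1}^m(-1)^{(i-1)|g|}f\circ_i g$ for $f\in\mathcal{O}(m)$. A multiplication on $\mathcal{O}$ is an element $\pi\in\mathcal{O}(2)$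 with $\pi\circ\pi=0$. It defines a differential $d_\pi:\mathcal{O}(n)\to\mathcal{O}(n+1)$, $d_\pi f=\pi\circ f-(-1)^{|f|}f\circ\pi$. For $f,g\in\mathcal{O}(1)$: $\{\pi\}\{f,g\}=(\pi\circ_2 g)\circ_1 f\in\mathcal{O}(2)$ (substitute $f$ into the first and $g$ into the second input of $\pi$), and $f\cdot g=(-1)^{|f|+1}\{\pi\}\{f,g\}=-\{\pi\}\{f,g\}$. For $D\in\mathcal{O}(1)$, $D^n$ is the $n$-fold composite $D\circ\cdots\circ D$, with $D^0=\mathrm{id}$. All operations are extended $\mathbb{K}[[t]]$-linearly to formal power series $\mathcal{O}(n)[[t]]$. A (formal one-parameter) deformation of $\pi$ is $\pi_t=\sum_{i\ge0}\pi_it^i\in\mathcal{O}(2)[[t]]$ with $\pi_0=\pi$ and $\pi_t\circ\pi_t=0$. *)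

theory Defs
  imports "HOL-Computational_Algebra.Formal_Power_Series"
begin

(* The spaces O(n), n >= 1, are subspaces of one ambient vector space 'v.  This is no restriction
   (any family of spaces embeds in its direct sum).  The subspaces may overlap, so pcomp takes the
   arities explicitly: pcomp m n i f g is  f o_i g  for f in O(m), g in O(n).  Values at n = 0 or
   outside the stated ranges are irrelevant. *)
record ('k, 'v) operad_data =
  smult :: "'k \<Rightarrow> 'v \<Rightarrow> 'v"
  component :: "nat \<Rightarrow> 'v set"
  pcomp :: "nat \<Rightarrow> nat \<Rightarrow> nat \<Rightarrow> 'v \<Rightarrow> 'v \<Rightarrow> 'v"
  ident :: "'v"

locale ns_operad = vector_space "smult P"
  for P :: "('k::field_char_0, 'v::ab_group_add) operad_data" +
  assumes component_subspace: "1 \<le> n \<Longrightarrow> subspace (component P n)"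
    and pcomp_closed:
      "\<lbrakk>1 \<le> i; i \<le> m; 1 \<le> n; f \<in> component P m; g \<in> component P n\<rbrakk>
        \<Longrightarrow> pcomp P m n i f g \<in> component P (m + n - 1)"
    and pcomp_add_left:
      "\<lbrakk>1 \<le> i; i \<le> m; 1 \<le> n; f \<in> component P m; f' \<in> component P m; g \<in> component P n\<rbrakk>
        \<Longrightarrow> pcomp P m n i (f + f') g = pcomp P m n i f g + pcomp P m n i f' g"
    and pcomp_add_right:
      "\<lbrakk>1 \<le> i; i \<le> m; 1 \<le> n; f \<in> component P m; g \<in> component P n; g' \<in> component P n\<rbrakk>
        \<Longrightarrow> pcomp P m n i f (g + g') = pcomp P m n i f g + pcomp P m n i f g'"
    and pcomp_smult_left:
      "\<lbrakk>1 \<le> i; i \<le> m; 1 \<le> n; f \<in> component P m; g \<in> component P n\<rbrakk>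
        \<Longrightarrow> pcomp P m n i (smult P c f) g = smult P c (pcomp P m n i f g)"
    and pcomp_smult_right:
      "\<lbrakk>1 \<le> i; i \<le> m; 1 \<le> n; f \<in> component P m; g \<in> component P n\<rbrakk>
        \<Longrightarrow> pcomp P m n i f (smult P c g) = smult P c (pcomp P m n i f g)"
    and pcomp_sequential:
      "\<lbrakk>1 \<le> i; i \<le> m; 1 \<le> j; j \<le> n; 1 \<le> p;
        f \<in> component P m; g \<in> component P n; h \<in> component P p\<rbrakk>
        \<Longrightarrow> pcomp P (m + n - 1) p (i + j - 1) (pcomp P m n i f g) h
          = pcomp P m (n + p - 1) i f (pcomp P n p j g h)"
    and pcomp_parallel:
      "\<lbrakk>1 \<le> i; i < j; j \<le> m; 1 \<le> n; 1 \<le> p;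
        f \<in> component P m; g \<in> component P n; h \<in> component P p\<rbrakk>
        \<Longrightarrow> pcomp P (m + n - 1) p (j + n - 1) (pcomp P m n i f g) h
          = pcomp P (m + p - 1) n i (pcomp P m p j f h) g"
    and ident_closed: "ident P \<in> component P 1"
    and pcomp_ident_right:
      "\<lbrakk>1 \<le> i; i \<le> m; f \<in> component P m\<rbrakk> \<Longrightarrow> pcomp P m 1 i f (ident P) = f"
    and pcomp_ident_left:
      "\<lbrakk>1 \<le> m; f \<in> component P m\<rbrakk> \<Longrightarrow> pcomp P 1 m 1 (ident P) f = f"

(* f o g for f in O(m), g in O(n); |g| = n - 1. *)
definition circ ::
  "('k::field_char_0, 'v::ab_group_add) operad_data \<Rightarrow> nat \<Rightarrow> nat \<Rightarrow> 'v \<Rightarrow> 'v \<Rightarrow> 'v" where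
  "circ P m n f g = (\<Sum>i=1..m. smult P ((-1) ^ ((i - 1) * (n - 1))) (pcomp P m n i f g))"

definition is_multiplication ::
  "('k::field_char_0, 'v::ab_group_add) operad_data \<Rightarrow> 'v \<Rightarrow> bool" where
  "is_multiplication P \<pi> \<longleftrightarrow> \<pi> \<in> component P 2 \<and> circ P 2 2 \<pi> \<pi> = 0"

(* d_pi on O(n). *)
definition differential ::
  "('k::field_char_0, 'v::ab_group_add) operad_data \<Rightarrow> 'v \<Rightarrow> nat \<Rightarrow> 'v \<Rightarrow> 'v" where
  "differential P \<pi> n f = circ P 2 n \<pi> f - smult P ((-1) ^ (n - 1)) (circ P n 2 f \<pi>)"

(* {pi}{f, g} for f, g in O(1). *)
definition brace ::
  "('k::field_char_0, 'v::ab_group_add) operad_data \<Rightarrow> 'v \<Rightarrow> 'v \<Rightarrow> 'v \<Rightarrow> 'v" where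
  "brace P \<pi> f g = pcomp P 2 1 1 (pcomp P 2 1 2 \<pi> g) f"

(* f . g for f, g in O(1); the exponent is |f| + 1 with |f| = 0. *)
definition dot ::
  "('k::field_char_0, 'v::ab_group_add) operad_data \<Rightarrow> 'v \<Rightarrow> 'v \<Rightarrow> 'v \<Rightarrow> 'v" where
  "dot P \<pi> f g = smult P ((-1) ^ (0 + 1)) (brace P \<pi> f g)"

primrec operad_power ::
  "('k::field_char_0, 'v::ab_group_add) operad_data \<Rightarrow> 'v \<Rightarrow> nat \<Rightarrow> 'v" where
  "operad_power P D 0 = ident P"
| "operad_power P D (Suc n) = circ P 1 1 D (operad_power P D n)"

(* O(n)[[t]]. *)
definition component_fps ::
  "('k::field_char_0, 'v::ab_group_add) operad_data \<Rightarrow> nat \<Rightarrow> 'v fps set" where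
  "component_fps P n = {F. \<forall>k. fps_nth F k \<in> component P n}"

(* The K[[t]]-bilinear extension of the circle product, with t^a t^b = t^(a+b). *)
definition circ_fps ::
  "('k::field_char_0, 'v::ab_group_add) operad_data
     \<Rightarrow> nat \<Rightarrow> nat \<Rightarrow> 'v fps \<Rightarrow> 'v fps \<Rightarrow> 'v fps" where
  "circ_fps P m n F G = Abs_fps (\<lambda>k. \<Sum>a=0..k. circ P m n (fps_nth F a) (fps_nth G (k - a)))"

definition is_deformation ::
  "('k::field_char_0, 'v::ab_group_add) operad_data \<Rightarrow> 'v \<Rightarrow> 'v fps \<Rightarrow> bool" where
  "is_deformation P \<pi> \<pi>t \<longleftrightarrow>
     \<pi>t \<in> component_fps P 2 \<and> fps_nth \<pi>t 0 = \<pi> \<and> circ_fps P 2 2 \<pi>t \<pi>t = 0"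

end

theory Submission
  imports Defs
begin

text \<open>Write \<open>p\<^sub>n = {\<pi>}{D\<^sup>n, E\<^sup>n} / n!\<close> with \<open>E\<close> the second cocycle. Since \<open>D\<close> and \<open>E\<close> commute and are
  cocycles, both are derivations of every \<open>p\<^sub>b\<close>, and
  \<open>(n + 1) p\<^sub>n\<^sub>+\<^sub>1\<close> arises from \<open>p\<^sub>n\<close> by plugging \<open>D\<close> into the first and \<open>E\<close> into the second input.
  Writing \<open>X\<^sub>i\<close> for plugging \<open>X\<close> into input \<open>i\<close>, the coefficients of \<open>\<pi>\<^sub>t \<circ>\<^sub>1 \<pi>\<^sub>t\<close> and of
  \<open>\<pi>\<^sub>t \<circ>\<^sub>2 \<pi>\<^sub>t\<close> therefore satisfy one and the same recursion
  \<open>(n + 1) q\<^sub>n\<^sub>+\<^sub>1 = (D\<^sub>1 E\<^sub>2 + D\<^sub>1 E\<^sub>3 + D\<^sub>2 E\<^sub>3) q\<^sub>n\<close>, and for \<open>n = 0\<close> they agree by associativity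
  of \<open>\<pi>\<close>.\<close>

text \<open>The Leibniz rule for the derivative of a Cauchy product, read off coefficientwise: the
  weight \<open>Suc n\<close> splits as \<open>a + (Suc n - a)\<close>, each half lowers one index,
  and the boundary term of weight 0 drops out.\<close>

lemma (in vector_space) antidiagonal_sum_Suc:
  fixes x :: "nat \<Rightarrow> nat \<Rightarrow> 'b"
  assumes "\<And>a b. scale (of_nat (Suc a)) (x (Suc a) b) = u a b"
    and "\<And>a b. scale (of_nat (Suc b)) (x a (Suc b)) = v a b"
  shows "scale (of_nat (Suc n)) (\<Sum>a=0..Suc n. x a (Suc n - a)) = (\<Sum>a=0..n. u a (n - a) + v a (n - a))"
proof -
  have "scale (of_nat (Suc n)) (\<Sum>a=0..Suc n. x a (Suc n - a))
      = (\<Sum>a=0..Suc n. scale (of_nat a) (x a (Suc n - a)) + scale (of_nat (Suc n - a)) (x a (Suc n - a)))"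
    unfolding scale_sum_right
  proof (rule sum.cong[OF refl])
    fix a assume "a \<in> {0..Suc n}"
    then have "of_nat (Suc n) = (of_nat a + of_nat (Suc n - a) :: 'a)"
      by (subst of_nat_add[symmetric]) simp
    then show "scale (of_nat (Suc n)) (x a (Suc n - a))
        = scale (of_nat a) (x a (Suc n - a)) + scale (of_nat (Suc n - a)) (x a (Suc n - a))"
      by (simp only: scale_left_distrib)
  qed
  also have "\<dots> = (\<Sum>a=0..Suc n. scale (of_nat a) (x a (Suc n - a)))
      + (\<Sum>a=0..Suc n. scale (of_nat (Suc n - a)) (x a (Suc n - a)))"
    by (rule sum.distrib)
  also have "(\<Sum>a=0..Suc n. scale (of_nat a) (x a (Suc n - a))) = (\<Sum>a=0..n. u a (n - a))"
    unfolding sum.atLeast0_atMost_Suc_shift using assms(1) by (simp del: of_nat_Suc)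
  also have "(\<Sum>a=0..Suc n. scale (of_nat (Suc n - a)) (x a (Suc n - a))) = (\<Sum>a=0..n. v a (n - a))"
    using assms(2) by (simp add: Suc_diff_le del: of_nat_Suc of_nat_diff of_nat_diff_if)
  finally show ?thesis
    by (simp add: sum.distrib)
qed

declare One_nat_def [simp del]

lemma sum_1_2: "(\<Sum>i=1..(2::nat). f i) = f 1 + f 2"
  by (simp add: numeral_2_eq_2 One_nat_def)

section \<open>Plugging unary operations into inputs\<close>

context ns_operad
begin

lemma component_closed:
  assumes "1 \<le> n"
  shows "0 \<in> component P n"
    and "f \<in> component P n \<Longrightarrow> g \<in> component P n \<Longrightarrow> f + g \<in> component P n"
    and "f \<in> component P n \<Longrightarrow> smult P c f \<in> component P n"
    and "(\<And>a. a \<in> A \<Longrightarrow> F a \<in> component P n) \<Longrightarrow> sum F A \<in> component P n"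
  using component_subspace[OF assms]
  by (auto intro: subspace_0 subspace_add subspace_scale subspace_sum)

abbreviation plug :: "nat \<Rightarrow> nat \<Rightarrow> 'v \<Rightarrow> 'v \<Rightarrow> 'v" where
  "plug m i X f \<equiv> pcomp P m 1 i f X"

lemma plug_closed:
  "\<lbrakk>1 \<le> i; i \<le> m; f \<in> component P m; X \<in> component P 1\<rbrakk> \<Longrightarrow> plug m i X f \<in> component P m"
  using pcomp_closed[of i m 1 f X] by simp

lemma plug_add:
  "\<lbrakk>1 \<le> i; i \<le> m; f \<in> component P m; g \<in> component P m; X \<in> component P 1\<rbrakk>
    \<Longrightarrow> plug m i X (f + g) = plug m i X f + plug m i X g"
  by (rule pcomp_add_left) auto

text \<open>The parallel axiom for unary operations, which do not shift the input numbers.\<close>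

lemma plug_commute:
  assumes "1 \<le> i" "i < j" "j \<le> m" "f \<in> component P m" "X \<in> component P 1" "Y \<in> component P 1"
  shows "plug m i X (plug m j Y f) = plug m j Y (plug m i X f)"
  using pcomp_parallel[of i j m 1 1 f X Y] assms by simp

text \<open>The operation plugged in later sits further from the root, hence \<open>X\<close> before
  \<open>Y\<close> in the composite.\<close>

lemma plug_plug:
  assumes "1 \<le> i" "i \<le> m" "f \<in> component P m" "X \<in> component P 1" "Y \<in> component P 1"
  shows "plug m i Y (plug m i X f) = plug m i (pcomp P 1 1 1 X Y) f"
  using pcomp_sequential[of i m 1 1 1 f X Y] assms by (simp flip: One_nat_def)

lemma plug_sum:
  assumes "1 \<le> i" "i \<le> m" "X \<in> component P 1" "\<And>a. a \<in> A \<Longrightarrow> F a \<in> component P m"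
  shows "plug m i X (sum F A) = (\<Sum>a\<in>A. plug m i X (F a))"
proof -
  \<comment> \<open>Covers the empty sum and also infinite \<open>A\<close>, where
    \<open>sum\<close> is 0 by convention.\<close>
  have zero: "plug m i X 0 = 0"
    using pcomp_smult_left[of i m 1 0 X 0] assms component_closed(1)[of m] by simp
  show ?thesis
  proof (cases "finite A")
    case True
    then show ?thesis using assms(4)
    proof induction
      case (insert a A)
      have "sum F A \<in> component P m"
        using insert.prems assms by (intro component_closed) auto
      with insert assms show ?case
        by (simp add: plug_add)
    qed (use zero in simp)
  qed (use zero in simp)
qed

text \<open>The Leibniz rule \<open>X(f(a,b)) = f(Xa,b) + f(a,Xb)\<close> in operadic form.\<close>

definition derivation_of :: "'v \<Rightarrow> 'v \<Rightarrow> bool" where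
  "derivation_of X f \<longleftrightarrow> pcomp P 1 2 1 X f = plug 2 1 X f + plug 2 2 X f"

text \<open>As \<open>X\<close> has degree 0, every sign in the differential's circle products is
  +1.\<close>

lemma derivation_of_if_cocycle:
  assumes "differential P f 1 X = 0"
  shows "derivation_of X f"
  using assms by (simp add: derivation_of_def differential_def circ_def sum_1_2)

lemma pcomp_plug:
  assumes "f \<in> component P 2" "X \<in> component P 1" "A \<in> component P 1" "1 \<le> i" "i \<le> 2"
  shows "pcomp P 1 2 1 X (plug 2 i A f) = plug 2 i A (pcomp P 1 2 1 X f)"
  using pcomp_sequential[of 1 1 i 2 1 X f A] assms by simp

text \<open>Both Leibniz terms of \<open>f\<close> survive plugging in \<open>A\<close>: at the same
  input \<open>X\<close> and \<open>A\<close> commute by hypothesis, at different inputs by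
  \<open>plug_commute\<close>.\<close>

lemma derivation_of_plug:
  assumes f: "f \<in> component P 2" and X: "X \<in> component P 1" and A: "A \<in> component P 1"
    and commute: "pcomp P 1 1 1 X A = pcomp P 1 1 1 A X"
    and "derivation_of X f" and i: "i = 1 \<or> i = 2"
  shows "derivation_of X (plug 2 i A f)"
proof -
  have "pcomp P 1 2 1 X (plug 2 i A f) = plug 2 i A (plug 2 1 X f + plug 2 2 X f)"
    using assms pcomp_plug[OF f X A] unfolding derivation_of_def by auto
  also have "\<dots> = plug 2 i A (plug 2 1 X f) + plug 2 i A (plug 2 2 X f)"
    using i f X A by (intro plug_add plug_closed) auto
  also have "\<dots> = plug 2 1 X (plug 2 i A f) + plug 2 2 X (plug 2 i A f)"
    using i
  proof
    assume "i = 1"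
    then show ?thesis
      using plug_plug[of 1 2 f] plug_commute[of 1 2 2 f A X] f X A commute by simp
  next
    assume "i = 2"
    then show ?thesis
      using plug_plug[of 2 2 f] plug_commute[of 1 2 2 f X A] f X A commute by simp
  qed
  finally show ?thesis unfolding derivation_of_def .
qed

section \<open>Powers and braces\<close>

lemma circ_1_1: "circ P 1 1 X Y = pcomp P 1 1 1 X Y"
  by (simp add: circ_def)

lemma operad_power_closed:
  "X \<in> component P 1 \<Longrightarrow> operad_power P X n \<in> component P 1"
  by (induction n) (use ident_closed plug_closed[of 1 1] in \<open>simp_all add: circ_1_1\<close>)

text \<open>\<open>operad_power\<close> adds the new factor on the left, whereas
  \<open>plug_plug\<close> produces it on the right.\<close>

lemma operad_power_commute:
  assumes "X \<in> component P 1"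
  shows "pcomp P 1 1 1 (operad_power P X n) X = operad_power P X (Suc n)"
proof (induction n)
  case 0
  then show ?case
    using pcomp_ident_left[of 1 X] pcomp_ident_right[of 1 1 X] assms by (simp add: circ_1_1)
next
  case (Suc n)
  then show ?case
    using plug_plug[of 1 1 X "operad_power P X n" X] operad_power_closed[OF assms, of n] assms
    by (simp add: circ_1_1)
qed

lemma brace_closed:
  "\<lbrakk>f \<in> component P 2; X \<in> component P 1; Y \<in> component P 1\<rbrakk> \<Longrightarrow> brace P f X Y \<in> component P 2"
  unfolding brace_def by (intro plug_closed) auto

text \<open>One factor is split off each power by \<open>plug_plug\<close>; plugs into different
  inputs commute, so both new factors can be moved outermost.\<close>

lemma brace_power_Suc:
  assumes "f \<in> component P 2" "X \<in> component P 1" "Y \<in> component P 1"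
  shows "brace P f (operad_power P X (Suc n)) (operad_power P Y (Suc n))
    = plug 2 2 Y (plug 2 1 X (brace P f (operad_power P X n) (operad_power P Y n)))"
proof -
  let ?X = "operad_power P X n" and ?Y = "operad_power P Y n"
  have c: "?X \<in> component P 1" "?Y \<in> component P 1"
    using assms operad_power_closed by auto
  have g: "plug 2 2 ?Y f \<in> component P 2"
    using assms c by (intro plug_closed) auto
  have "brace P f (operad_power P X (Suc n)) (operad_power P Y (Suc n))
      = plug 2 1 X (plug 2 1 ?X (plug 2 2 Y (plug 2 2 ?Y f)))"
    unfolding brace_def operad_power_commute[OF assms(2), symmetric] operad_power_commute[OF assms(3), symmetric]
    using assms c g by (subst (1 2) plug_plug) (auto intro!: plug_closed)
  also have "\<dots> = plug 2 1 X (plug 2 2 Y (plug 2 1 ?X (plug 2 2 ?Y f)))"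
    using plug_commute[of 1 2 2 "plug 2 2 ?Y f" ?X Y] assms c g by simp
  also have "\<dots> = plug 2 2 Y (plug 2 1 X (plug 2 1 ?X (plug 2 2 ?Y f)))"
    using assms c g by (intro plug_commute plug_closed) auto
  finally show ?thesis by (simp add: brace_def)
qed

section \<open>The common recursion for the two partial compositions\<close>

context
  fixes D E :: 'v and p :: "nat \<Rightarrow> 'v"
  assumes D: "D \<in> component P 1" and E: "E \<in> component P 1"
    and p: "p n \<in> component P 2"
    and p_Suc: "smult P (of_nat (Suc n)) (p (Suc n)) = plug 2 2 E (plug 2 1 D (p n))"
    and der_D: "derivation_of D (p n)" and der_E: "derivation_of E (p n)"
begin

text \<open>All ways to put \<open>D\<close> on an earlier and \<open>E\<close> on a later of three
  inputs; this does not depend on how the ternary operation is bracketed.\<close>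

definition total :: "'v \<Rightarrow> 'v" where
  "total f = plug 3 3 E (plug 3 1 D f) + plug 3 3 E (plug 3 2 D f) + plug 3 2 E (plug 3 1 D f)"

abbreviation comp1 :: "'v \<Rightarrow> 'v \<Rightarrow> 'v" where "comp1 f g \<equiv> pcomp P 2 2 1 f g"
abbreviation comp2 :: "'v \<Rightarrow> 'v \<Rightarrow> 'v" where "comp2 f g \<equiv> pcomp P 2 2 2 f g"

lemma comp_closed:
  assumes "f \<in> component P 2" "g \<in> component P 2"
  shows "comp1 f g \<in> component P 3" "comp2 f g \<in> component P 3"
  using pcomp_closed[of 1 2 2 f g] pcomp_closed[of 2 2 2 f g] assms by auto

text \<open>Renumbering of inputs under grafting. In the last two equations \<open>X\<close> lies on
  the inner edge, so it acts on the output of \<open>g\<close>.\<close>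

lemma plug_comp:
  assumes f: "f \<in> component P 2" and g: "g \<in> component P 2" and X: "X \<in> component P 1"
  shows "comp1 f (plug 2 1 X g) = plug 3 1 X (comp1 f g)"
    and "comp1 f (plug 2 2 X g) = plug 3 2 X (comp1 f g)"
    and "comp2 f (plug 2 1 X g) = plug 3 2 X (comp2 f g)"
    and "comp2 f (plug 2 2 X g) = plug 3 3 X (comp2 f g)"
    and "comp1 (plug 2 2 X f) g = plug 3 3 X (comp1 f g)"
    and "comp2 (plug 2 1 X f) g = plug 3 1 X (comp2 f g)"
    and "comp1 (plug 2 1 X f) g = comp1 f (pcomp P 1 2 1 X g)"
    and "comp2 (plug 2 2 X f) g = comp2 f (pcomp P 1 2 1 X g)"
  using pcomp_sequential[of 1 2 1 2 1 f g X] pcomp_sequential[of 1 2 2 2 1 f g X]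
    pcomp_sequential[of 2 2 1 2 1 f g X] pcomp_sequential[of 2 2 2 2 1 f g X]
    pcomp_parallel[of 1 2 2 2 1 f g X] pcomp_parallel[of 1 2 2 1 2 f X g]
    pcomp_sequential[of 1 2 1 1 2 f X g] pcomp_sequential[of 2 2 1 1 2 f X g] assms
  by (simp_all flip: One_nat_def)

text \<open>\<open>D\<close> lies on the edge leading to \<open>p b\<close> and spreads over inputs
  1 and 2 by \<open>der_D\<close>; \<open>E\<close> moves to input 3.\<close>

lemma comp1_Suc_left:
  "smult P (of_nat (Suc a)) (comp1 (p (Suc a)) (p b))
    = plug 3 3 E (plug 3 1 D (comp1 (p a) (p b))) + plug 3 3 E (plug 3 2 D (comp1 (p a) (p b)))"
proof -
  have "smult P (of_nat (Suc a)) (comp1 (p (Suc a)) (p b)) = comp1 (plug 2 2 E (plug 2 1 D (p a))) (p b)"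
    using p by (subst pcomp_smult_left[symmetric]) (auto simp: p_Suc simp del: of_nat_Suc)
  also have "\<dots> = plug 3 3 E (comp1 (plug 2 1 D (p a)) (p b))"
    using p D E by (intro plug_comp plug_closed) auto
  also have "comp1 (plug 2 1 D (p a)) (p b) = comp1 (p a) (plug 2 1 D (p b) + plug 2 2 D (p b))"
    using p D der_D[of b] by (simp add: plug_comp derivation_of_def)
  also have "\<dots> = plug 3 1 D (comp1 (p a) (p b)) + plug 3 2 D (comp1 (p a) (p b))"
    using p D by (subst pcomp_add_right) (auto intro!: plug_closed simp: plug_comp)
  finally show ?thesis
    using p D E by (subst (asm) plug_add) (auto intro!: plug_closed comp_closed)
qed

text \<open>Here \<open>p b\<close> occupies inputs 1 and 2.\<close>

lemma comp1_Suc_right: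
  "smult P (of_nat (Suc b)) (comp1 (p a) (p (Suc b))) = plug 3 2 E (plug 3 1 D (comp1 (p a) (p b)))"
proof -
  have "smult P (of_nat (Suc b)) (comp1 (p a) (p (Suc b))) = comp1 (p a) (plug 2 2 E (plug 2 1 D (p b)))"
    using p by (subst pcomp_smult_right[symmetric]) (auto simp: p_Suc simp del: of_nat_Suc)
  then show ?thesis
    using p D E plug_closed[of 1 2 "p b" D] by (simp add: plug_comp)
qed

text \<open>Mirror image of \<open>comp1_Suc_left\<close>: now \<open>E\<close> lies on the inner
  edge and spreads over inputs 2 and 3 by \<open>der_E\<close>, while \<open>D\<close> stays at
  input 1.\<close>

lemma comp2_Suc_left:
  "smult P (of_nat (Suc a)) (comp2 (p (Suc a)) (p b))
    = plug 3 2 E (plug 3 1 D (comp2 (p a) (p b))) + plug 3 3 E (plug 3 1 D (comp2 (p a) (p b)))"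
proof -
  have "smult P (of_nat (Suc a)) (comp2 (p (Suc a)) (p b)) = comp2 (plug 2 2 E (plug 2 1 D (p a))) (p b)"
    using p by (subst pcomp_smult_left[symmetric]) (auto simp: p_Suc simp del: of_nat_Suc)
  also have "\<dots> = comp2 (plug 2 1 D (p a)) (pcomp P 1 2 1 E (p b))"
    using p D E by (intro plug_comp plug_closed) auto
  also have "\<dots> = comp2 (plug 2 1 D (p a)) (plug 2 1 E (p b) + plug 2 2 E (p b))"
    using der_E[of b] by (simp add: derivation_of_def)
  also have "\<dots> = plug 3 2 E (comp2 (plug 2 1 D (p a)) (p b)) + plug 3 3 E (comp2 (plug 2 1 D (p a)) (p b))"
    using p D E plug_closed[of 1 2 "p a" D]
    by (subst pcomp_add_right) (auto intro!: plug_closed simp: plug_comp(3,4))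
  finally show ?thesis
    using p D by (simp add: plug_comp)
qed

text \<open>Here \<open>p b\<close> occupies inputs 2 and 3.\<close>

lemma comp2_Suc_right:
  "smult P (of_nat (Suc b)) (comp2 (p a) (p (Suc b))) = plug 3 3 E (plug 3 2 D (comp2 (p a) (p b)))"
proof -
  have "smult P (of_nat (Suc b)) (comp2 (p a) (p (Suc b))) = comp2 (p a) (plug 2 2 E (plug 2 1 D (p b)))"
    using p by (subst pcomp_smult_right[symmetric]) (auto simp: p_Suc simp del: of_nat_Suc)
  then show ?thesis
    using p D E plug_closed[of 1 2 "p b" D] by (simp add: plug_comp)
qed

lemma total_sum:
  assumes "\<And>a. a \<in> A \<Longrightarrow> F a \<in> component P 3"
  shows "total (sum F A) = (\<Sum>a\<in>A. total (F a))"
  using assms D E by (simp add: total_def plug_sum plug_closed sum.distrib)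

lemma antidiagonal_sum_comp_eq:
  assumes "comp1 (p 0) (p 0) = comp2 (p 0) (p 0)"
  shows "(\<Sum>a=0..n. comp1 (p a) (p (n - a))) = (\<Sum>a=0..n. comp2 (p a) (p (n - a)))"
proof (induction n)
  case 0
  then show ?case using assms by simp
next
  case (Suc n)
  \<comment> \<open>The left and right recursions together yield each of the three terms of
    \<open>total\<close> exactly once; likewise for \<open>comp2\<close> below.\<close>
  have "smult P (of_nat (Suc n)) (\<Sum>a=0..Suc n. comp1 (p a) (p (Suc n - a)))
      = total (\<Sum>a=0..n. comp1 (p a) (p (n - a)))"
    unfolding antidiagonal_sum_Suc[of "\<lambda>a b. comp1 (p a) (p b)", OF comp1_Suc_left comp1_Suc_right]
    using p by (subst total_sum) (auto intro: comp_closed simp: total_def add_ac)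
  moreover have "smult P (of_nat (Suc n)) (\<Sum>a=0..Suc n. comp2 (p a) (p (Suc n - a)))
      = total (\<Sum>a=0..n. comp2 (p a) (p (n - a)))"
    unfolding antidiagonal_sum_Suc[of "\<lambda>a b. comp2 (p a) (p b)", OF comp2_Suc_left comp2_Suc_right]
    using p by (subst total_sum) (auto intro: comp_closed simp: total_def add_ac)
  ultimately have "smult P (of_nat (Suc n)) (\<Sum>a=0..Suc n. comp1 (p a) (p (Suc n - a)))
      = smult P (of_nat (Suc n)) (\<Sum>a=0..Suc n. comp2 (p a) (p (Suc n - a)))"
    using Suc by simp
  \<comment> \<open>Characteristic 0 allows cancelling \<open>Suc n\<close>.\<close>
  then show ?case
    by (simp only: scale_cancel_left of_nat_eq_0_iff) simp
qed

end

section \<open>The exponential series is a deformation\<close>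

lemma circ_2_2:
  "circ P 2 2 f g = pcomp P 2 2 1 f g - pcomp P 2 2 2 f g"
  by (simp add: circ_def sum_1_2)

lemma derivation_of_smult:
  assumes "f \<in> component P 2" "X \<in> component P 1" "derivation_of X f"
  shows "derivation_of X (smult P c f)"
  using assms by (simp add: derivation_of_def pcomp_smult_left pcomp_smult_right scale_right_distrib)

lemma is_deformation_exp_brace:
  assumes "is_multiplication P \<pi>"
    and D: "D \<in> component P 1" and E: "E \<in> component P 1"
    and dD: "differential P \<pi> 1 D = 0" and dE: "differential P \<pi> 1 E = 0"
    and commute: "pcomp P 1 1 1 D E = pcomp P 1 1 1 E D"
  shows "is_deformation P \<pi>
    (Abs_fps (\<lambda>n. smult P (1 / fact n) (brace P \<pi> (operad_power P D n) (operad_power P E n))))"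
proof -
  \<comment> \<open>The sign at input 2 is -1, so a vanishing circle square means
    associativity.\<close>
  have \<pi>: "\<pi> \<in> component P 2" and assoc: "pcomp P 2 2 1 \<pi> \<pi> = pcomp P 2 2 2 \<pi> \<pi>"
    using assms(1) by (auto simp: is_multiplication_def circ_2_2)
  \<comment> \<open>Without the factorial, each step from \<open>b n\<close> to
    \<open>b (Suc n)\<close> only plugs in \<open>D\<close> and \<open>E\<close>, so the Leibniz
    rules propagate by induction.\<close>
  define b where "b n = brace P \<pi> (operad_power P D n) (operad_power P E n)" for n
  define p where "p n = smult P (1 / fact n) (b n)" for n
  have b0: "b 0 = \<pi>"
    using pcomp_ident_right[of _ 2 \<pi>] \<pi> by (simp add: b_def brace_def)
  have b: "b n \<in> component P 2" for n
    unfolding b_def using \<pi> D E by (intro brace_closed operad_power_closed)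
  have b_Suc: "b (Suc n) = plug 2 2 E (plug 2 1 D (b n))" for n
    unfolding b_def by (rule brace_power_Suc[OF \<pi> D E])
  have "derivation_of D (b n) \<and> derivation_of E (b n)" for n
  proof (induction n)
    case 0
    then show ?case using dD dE by (simp add: b0 derivation_of_if_cocycle)
  next
    case (Suc n)
    then show ?case
      unfolding b_Suc using b[of n] D E commute
      by (auto intro!: derivation_of_plug plug_closed)
  qed
  then have der: "derivation_of D (p n)" "derivation_of E (p n)" for n
    using b D E by (auto simp: p_def intro: derivation_of_smult)
  have p: "p n \<in> component P 2" for n
    unfolding p_def using b by (intro component_closed) auto
  have p0: "p 0 = \<pi>" by (simp add: p_def b0)
  have p_Suc: "smult P (of_nat (Suc n)) (p (Suc n)) = plug 2 2 E (plug 2 1 D (p n))" for n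
  proof -
    have "smult P (of_nat (Suc n)) (p (Suc n)) = smult P (1 / fact n) (b (Suc n))"
      by (simp add: p_def del: of_nat_Suc)
    also have "\<dots> = plug 2 2 E (plug 2 1 D (p n))"
      using b[of n] D E plug_closed[of 1 2 "b n" D] by (simp add: p_def b_Suc pcomp_smult_left)
    finally show ?thesis .
  qed
  \<comment> \<open>This coefficient is the difference of the two antidiagonal sums.\<close>
  have "(\<Sum>a=0..n. circ P 2 2 (p a) (p (n - a))) = 0" for n
    using antidiagonal_sum_comp_eq[OF D E p p_Suc der, of n] assoc
    by (simp add: circ_2_2 sum_subtractf p0)
  then have "is_deformation P \<pi> (Abs_fps p)"
    using p p0 by (simp add: is_deformation_def component_fps_def circ_fps_def fps_eq_iff)
  then show ?thesis by (simp add: p_def[abs_def] b_def)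
qed

end

theorem theorem3p10:
  fixes P :: "('k::field_char_0, 'v::ab_group_add) operad_data"
    and \<pi> D Dbar :: 'v
  assumes "ns_operad P"
    and "is_multiplication P \<pi>"
    and "D \<in> component P 1" and "Dbar \<in> component P 1"
    and "differential P \<pi> 1 D = 0" and "differential P \<pi> 1 Dbar = 0"
    and "circ P 1 1 D Dbar = circ P 1 1 Dbar D"
  shows "let \<pi>t = Abs_fps (\<lambda>n. smult P (1 / fact n)
                    (brace P \<pi> (operad_power P D n) (operad_power P Dbar n)))
         in \<pi>t = - Abs_fps (\<lambda>n. smult P (1 / fact n)
                    (dot P \<pi> (operad_power P D n) (operad_power P Dbar n)))
            \<and> is_deformation P \<pi> \<pi>t"
proof -
  interpret ns_operad P by fact
  show ?thesis
    unfolding Let_def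
  proof
    show "is_deformation P \<pi> (Abs_fps (\<lambda>n. smult P (1 / fact n)
        (brace P \<pi> (operad_power P D n) (operad_power P Dbar n))))"
      using assms(7) by (intro is_deformation_exp_brace assms(2-6)) (simp only: circ_1_1)
  \<comment> \<open>The sign in \<open>dot\<close> cancels the outer minus.\<close>
  qed (simp add: fps_eq_iff dot_def)
qed

end
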